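(* Let $\mathsf a$ be a uniformly superlinear action cost on a set $X$. Then every curve $u:[a,b]\to X$ with $\mathbb A(u;[a,b])<\infty$ belongs to $\mathrm{AC}_{\mathsf a}([a,b];X)$.
   Context: An action cost on a set $X$ is a function $\mathsf a:(0,+\infty)\times X\times X\to[0,+\infty)$ such that for all $\tau,\tau_1,\tau_2>0$ and $u_1,u_2,u_3\in X$: (i) $\mathsf a(\tau,u_1,u_2)=0$ if and only if $u_1=u_2$; (ii) $\mathsf a(\tau,u_1,u_2)=\mathsf a(\tau,u_2,u_1)$; (iii) $\mathsf a(\tau_1+\tau_2,u_1,u_3)\le \mathsf a(\tau_1,u_1,u_2)+\mathsf a(\tau_2,u_2,u_3)$. The action cost $\mathsf a$ is uniformly superlinear if there exist an action cost $\mathsf b$ on $X$, a convex superlinear function $\psi:[0,+\infty)\to[0,+\infty)$ (i.e. $\lim_{r\to+\infty}\psi(r)/r=+\infty$), and a constant $\lambda\ge1$ such that $\lambda^{-1}\tau\,\psi(\tau^{-1}\mathsf b(\tau,u,v))\le\mathsf a(\tau,u,v)\le\lambda\tau\,\psi(\tau^{-1}\mathsf b(\tau,u,v))$ for every $\tau>0$, $u,v\in X$. The $\mathsf a$-action of a curve $u:[a,b]\to X$ is $\mathbb A(u;[a,b]):=\sup\sum_{j=1}^M\mathsf a(t^j-t^{j-1},u(t^{j-1}),u(t^j))$, the supremum being over all finite partitions $a=t^0<t^1<\dots<t^M=b$. A curve $u:[a,b]\to X$ is $\mathsf a$-absolutely continuous, $u\in\mathrm{AC}_{\mathsf a}([a,b];X)$,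 if there exists $g\in L^1(a,b)$ such that $\mathsf a(t-s,u(s),u(t))\le\int_s^tg(r)\,\mathrm dr$ for all $a\le s<t\le b$. *)

theory Defs
  imports "HOL-Analysis.Analysis"
begin

(* Only values at positive first argument and at points of X are constrained; elsewhere the
   (total) function is arbitrary and never used. *)
definition action_cost :: "'x set \<Rightarrow> (real \<Rightarrow> 'x \<Rightarrow> 'x \<Rightarrow> real) \<Rightarrow> bool" where
  "action_cost X \<a> \<longleftrightarrow>
     (\<forall>\<tau>>0. \<forall>u\<in>X. \<forall>v\<in>X. 0 \<le> \<a> \<tau> u v) \<and>
     (\<forall>\<tau>>0. \<forall>u\<in>X. \<forall>v\<in>X. \<a> \<tau> u v = 0 \<longleftrightarrow> u = v) \<and>
     (\<forall>\<tau>>0. \<forall>u\<in>X. \<forall>v\<in>X. \<a> \<tau> u v = \<a> \<tau> v u) \<and>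
     (\<forall>\<tau>\<^sub>1>0. \<forall>\<tau>\<^sub>2>0. \<forall>u\<in>X. \<forall>v\<in>X. \<forall>w\<in>X.
        \<a> (\<tau>\<^sub>1 + \<tau>\<^sub>2) u w \<le> \<a> \<tau>\<^sub>1 u v + \<a> \<tau>\<^sub>2 v w)"

definition convex_superlinear :: "(real \<Rightarrow> real) \<Rightarrow> bool" where
  "convex_superlinear \<psi> \<longleftrightarrow>
     (\<forall>r\<ge>0. 0 \<le> \<psi> r) \<and> convex_on {0..} \<psi> \<and>
     filterlim (\<lambda>r. \<psi> r / r) at_top at_top"

definition uniformly_superlinear :: "'x set \<Rightarrow> (real \<Rightarrow> 'x \<Rightarrow> 'x \<Rightarrow> real) \<Rightarrow> bool" where
  "uniformly_superlinear X \<a> \<longleftrightarrow>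
     (\<exists>\<b> \<psi> \<Lambda>. action_cost X \<b> \<and> convex_superlinear \<psi> \<and> \<Lambda> \<ge> 1 \<and>
        (\<forall>\<tau>>0. \<forall>u\<in>X. \<forall>v\<in>X.
           inverse \<Lambda> * (\<tau> * \<psi> (inverse \<tau> * \<b> \<tau> u v)) \<le> \<a> \<tau> u v \<and>
           \<a> \<tau> u v \<le> \<Lambda> * (\<tau> * \<psi> (inverse \<tau> * \<b> \<tau> u v))))"

(* (M, t) encodes a = t 0 < t 1 < ... < t M = b; values of t beyond M are irrelevant.
   M = 0 occurs only for a = b. *)
definition partitions :: "real \<Rightarrow> real \<Rightarrow> (nat \<times> (nat \<Rightarrow> real)) set" where
  "partitions a b = {(M, t). t 0 = a \<and> t M = b \<and> (\<forall>j\<in>{1..M}. t (j - 1) < t j)}"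

definition action ::
  "(real \<Rightarrow> 'x \<Rightarrow> 'x \<Rightarrow> real) \<Rightarrow> (real \<Rightarrow> 'x) \<Rightarrow> real \<Rightarrow> real \<Rightarrow> ereal" where
  "action \<a> u a b =
     (SUP (M, t)\<in>partitions a b.
        ereal (\<Sum>j=1..M. \<a> (t j - t (j - 1)) (u (t (j - 1))) (u (t j))))"

definition AC ::
  "'x set \<Rightarrow> (real \<Rightarrow> 'x \<Rightarrow> 'x \<Rightarrow> real) \<Rightarrow> real \<Rightarrow> real \<Rightarrow> (real \<Rightarrow> 'x) set" where
  "AC X \<a> a b =
     {u \<in> {a..b} \<rightarrow> X. \<exists>g :: real \<Rightarrow> real. set_integrable lebesgue {a<..<b} g \<and>
        (\<forall>s t. a \<le> s \<and> s < t \<and> t \<le> b \<longrightarrow>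
           \<a> (t - s) (u s) (u t) \<le> (LINT r:{s<..<t}|lebesgue. g r))}"

end

theory Submission
  imports Defs
begin

text \<open>
  Let \<open>\<b>\<close> and \<open>\<psi>\<close> be such that \<open>\<a> \<tau> v w\<close> is comparable with \<open>\<tau> * \<psi> (\<b> \<tau> v w / \<tau>)\<close>. The action of
  \<open>u\<close> itself may a priori charge single points or Lebesgue null sets, so its variation function
  is not obviously an integral. The \<open>\<b>\<close>-variation \<open>F\<close> of \<open>u\<close> is better behaved, by
  superlinearity: \<open>p * r \<le> q + \<psi> r\<close> for every slope \<open>p\<close> and a suitable \<open>q\<close>, and therefore
  \<open>p * (F t - F s) \<le> q * (t - s) + (V t - V s)\<close>, where \<open>V\<close> is \<open>\<Lambda>\<close> times the variation function
  of the \<open>\<a>\<close>-action. Because \<open>V\<close> is bounded and \<open>p\<close> is arbitrary, \<open>F\<close> is absolutely continuous.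

  Taking \<open>p\<close> as the slope of a supporting line of \<open>\<psi>\<close> sharpens this to
  \<open>(t - s) * \<psi> ((F t - F s) / (t - s)) \<le> V t - V s\<close>, and the classical theorem of Riesz and
  Medvedev (\<open>Riesz_Medvedev\<close>) gives \<open>F t - F s = \<integral>\<beta>\<close> over \<open>{s<..t}\<close> with \<open>\<psi> \<circ> \<beta>\<close> integrable.
  Jensen's inequality (\<open>Jensen_Ioc\<close>) then turns \<open>\<b> (t - s) (u s) (u t) \<le> F t - F s\<close> into
  \<open>\<a> (t - s) (u s) (u t) \<le> \<integral>\<Lambda> * \<psi> (\<beta> r)\<close>, so \<open>\<Lambda> * (\<psi> \<circ> \<beta>)\<close> is the required function.

  The triangle inequality of \<open>\<b>\<close> is used to see that \<open>F t - F s\<close> is exactly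
  the \<open>\<b>\<close>-variation on \<open>{s..t}\<close> (\<open>variation_superadditive\<close>, \<open>variation_subadditive\<close>).
\<close>

section \<open>Sums along partitions and variation\<close>

text \<open>
  A partition enters the argument only through the value of its sum. Generating these values one
  interval at a time makes concatenation and the insertion of a new partition point inductions
  over the derivation, with no bookkeeping of indices.
\<close>
inductive chain_sum :: "(real \<Rightarrow> real \<Rightarrow> real) \<Rightarrow> real \<Rightarrow> real \<Rightarrow> real \<Rightarrow> bool"
  for f :: "real \<Rightarrow> real \<Rightarrow> real" where
  refl: "chain_sum f s s 0"
| step: "chain_sum f s t S \<Longrightarrow> t < r \<Longrightarrow> chain_sum f s r (S + f t r)"

lemma chain_sum_le: "chain_sum f s t S \<Longrightarrow> s \<le> t"
  by (induction rule: chain_sum.induct) auto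

lemma chain_sum_single: "s < t \<Longrightarrow> chain_sum f s t (f s t)"
  using chain_sum.step[OF chain_sum.refl, of s t f] by simp

lemma chain_sum_exists: "s \<le> t \<Longrightarrow> \<exists>S. chain_sum f s t S"
  using chain_sum_single[of s t f] chain_sum.refl[of f s] by (cases "s = t") auto

lemma chain_sum_append:
  assumes "chain_sum f t r S'" "chain_sum f s t S"
  shows "chain_sum f s r (S + S')"
  using assms
proof (induction rule: chain_sum.induct)
  case (step t r S' q)
  then show ?case
    using chain_sum.step[of f s r "S + S'" q] by (simp add: add.assoc)
qed auto

lemma chain_sum_nonneg:
  assumes "chain_sum f s t S" "\<And>x y. s \<le> x \<Longrightarrow> x < y \<Longrightarrow> y \<le> t \<Longrightarrow> 0 \<le> f x y"
  shows "0 \<le> S"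
  using assms
proof (induction rule: chain_sum.induct)
  case (step s t S r)
  then show ?case
    using chain_sum_le[OF step.hyps(1)] by (intro add_nonneg_nonneg) auto
qed auto

text \<open>
  Only the interval that contains \<open>m\<close> in its interior is cut, so the triangle inequality is needed
  at \<open>m\<close> alone.
\<close>
lemma chain_sum_split:
  assumes "chain_sum f s t S" "s \<le> m" "m \<le> t"
    and "\<And>x y. s \<le> x \<Longrightarrow> x < m \<Longrightarrow> m < y \<Longrightarrow> y \<le> t \<Longrightarrow> f x y \<le> f x m + f m y"
  shows "\<exists>S1 S2. chain_sum f s m S1 \<and> chain_sum f m t S2 \<and> S \<le> S1 + S2"
  using assms
proof (induction rule: chain_sum.induct)
  case (refl s)
  then have "m = s" by simp
  then show ?case using chain_sum.refl[of f s] by fastforce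
next
  case (step s t S r)
  show ?case
  proof (cases "m \<le> t")
    case True
    then obtain S1 S2 where S: "chain_sum f s m S1" "chain_sum f m t S2" "S \<le> S1 + S2"
      using step.IH step.prems step.hyps by fastforce
    have "chain_sum f m r (S2 + f t r)" using S(2) step.hyps(2) by (rule chain_sum.step)
    then show ?thesis using S(1,3) by fastforce
  next
    case False
    then have 1: "chain_sum f s m (S + f t m)" using step.hyps by (auto intro: chain_sum.step)
    show ?thesis
    proof (cases "m = r")
      case True
      then show ?thesis using 1 chain_sum.refl[of f m] by force
    next
      case mr: False
      then have "chain_sum f m r (f m r)" using step.prems by (auto intro: chain_sum_single)
      moreover have "f t r \<le> f t m + f m r"
        using step.prems False mr chain_sum_le[OF step.hyps(1)] by auto
      ultimately show ?thesis using 1 by (smt (verit))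
    qed
  qed
qed

text \<open>
  An affine estimate passes from single intervals to sums because the lengths add up. This
  is the reason why the superlinear function is always used through its affine minorants.
\<close>
lemma chain_sum_compare:
  assumes "chain_sum f s t S"
    and "\<And>x y. s \<le> x \<Longrightarrow> x < y \<Longrightarrow> y \<le> t \<Longrightarrow> p * f x y \<le> q * (y - x) + c * g x y"
  shows "\<exists>S'. chain_sum g s t S' \<and> p * S \<le> q * (t - s) + c * S'"
  using assms
proof (induction rule: chain_sum.induct)
  case (refl s)
  then show ?case using chain_sum.refl[of g s] by fastforce
next
  case (step s t S r)
  then obtain S' where S': "chain_sum g s t S'" "p * S \<le> q * (t - s) + c * S'"
    by fastforce
  moreover have "p * f t r \<le> q * (r - t) + c * g t r"
    using step.prems step.hyps(2) chain_sum_le[OF step.hyps(1)] by auto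
  ultimately have "p * (S + f t r) \<le> q * (r - s) + c * (S' + g t r)"
    by (simp add: algebra_simps)
  then show ?case using chain_sum.step[OF S'(1) step.hyps(2)] by blast
qed

lemma chain_sum_partition:
  assumes "chain_sum f s t S"
  shows "\<exists>M \<tau>. (M, \<tau>) \<in> partitions s t \<and> S = (\<Sum>j=1..M. f (\<tau> (j - 1)) (\<tau> j))"
  using assms
proof (induction rule: chain_sum.induct)
  case (refl s)
  show ?case by (rule exI[of _ 0], rule exI[of _ "\<lambda>_. s"]) (simp add: partitions_def)
next
  case (step s t S r)
  then obtain M \<tau> where P: "(M, \<tau>) \<in> partitions s t"
    and S: "S = (\<Sum>j=1..M. f (\<tau> (j - 1)) (\<tau> j))" by blast
  let ?\<tau> = "\<tau>(Suc M := r)"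
  have "(Suc M, ?\<tau>) \<in> partitions s r"
    using P step.hyps(2) by (auto simp: partitions_def le_Suc_eq)
  moreover have "(\<Sum>j=1..Suc M. f (?\<tau> (j - 1)) (?\<tau> j)) = (\<Sum>j=1..M. f (\<tau> (j - 1)) (\<tau> j)) + f t r"
  proof -
    have "(\<Sum>j=1..M. f (?\<tau> (j - 1)) (?\<tau> j)) = (\<Sum>j=1..M. f (\<tau> (j - 1)) (\<tau> j))"
      by (intro sum.cong) auto
    then show ?thesis using P by (simp add: partitions_def)
  qed
  ultimately show ?case using S by metis
qed

definition variation :: "(real \<Rightarrow> real \<Rightarrow> real) \<Rightarrow> real \<Rightarrow> real \<Rightarrow> real" where
  "variation f s t = Sup {S. chain_sum f s t S}"

locale bounded_variation =
  fixes f :: "real \<Rightarrow> real \<Rightarrow> real" and a b K :: real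
  assumes nonneg: "a \<le> x \<Longrightarrow> x < y \<Longrightarrow> y \<le> b \<Longrightarrow> 0 \<le> f x y"
    and bound: "chain_sum f a b S \<Longrightarrow> S \<le> K"
begin

lemma chain_bound:
  assumes "a \<le> s" "t \<le> b" "chain_sum f s t S"
  shows "0 \<le> S" "S \<le> K"
proof -
  have st: "s \<le> t" using assms(3) by (rule chain_sum_le)
  show "0 \<le> S" using assms by (intro chain_sum_nonneg[OF assms(3)] nonneg) auto
  obtain S1 where 1: "chain_sum f a s S1" using chain_sum_exists assms by blast
  obtain S2 where 2: "chain_sum f t b S2" using chain_sum_exists assms by blast
  have "0 \<le> S1" using assms st by (intro chain_sum_nonneg[OF 1] nonneg) auto
  moreover have "0 \<le> S2" using assms st by (intro chain_sum_nonneg[OF 2] nonneg) auto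
  moreover have "S1 + S + S2 \<le> K"
    using bound[OF chain_sum_append[OF 2 chain_sum_append[OF assms(3) 1]]] .
  ultimately show "S \<le> K" by simp
qed

lemma bdd: "a \<le> s \<Longrightarrow> t \<le> b \<Longrightarrow> bdd_above {S. chain_sum f s t S}"
  using chain_bound(2) by (auto intro!: bdd_aboveI)

lemma chain_le_variation:
  "a \<le> s \<Longrightarrow> t \<le> b \<Longrightarrow> chain_sum f s t S \<Longrightarrow> S \<le> variation f s t"
  unfolding variation_def by (intro cSup_upper bdd) auto

lemma variation_leI:
  assumes "s \<le> t" "\<And>S. chain_sum f s t S \<Longrightarrow> S \<le> c"
  shows "variation f s t \<le> c"
  unfolding variation_def using assms chain_sum_exists[of s t f] by (intro cSup_least) auto

lemma variation_range:
  assumes "a \<le> s" "s \<le> t" "t \<le> b"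
  shows "0 \<le> variation f s t" "variation f s t \<le> K"
proof -
  obtain S where S: "chain_sum f s t S" using chain_sum_exists assms by blast
  show "0 \<le> variation f s t"
    using chain_le_variation[OF assms(1,3) S] chain_bound[OF assms(1,3) S] by simp
  show "variation f s t \<le> K" using assms chain_bound by (intro variation_leI) auto
qed

lemma variation_superadditive:
  assumes "a \<le> s" "s \<le> t" "t \<le> r" "r \<le> b"
  shows "variation f s t + variation f t r \<le> variation f s r"
proof -
  have "S \<le> variation f s r - variation f t r" if S: "chain_sum f s t S" for S
  proof -
    have "variation f t r \<le> variation f s r - S"
      using assms chain_le_variation[of s r] chain_sum_append[OF _ S]
      by (intro variation_leI) (force simp: le_diff_eq add.commute)+
    then show ?thesis by simp
  qed
  then have "variation f s t \<le> variation f s r - variation f t r"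
    using assms by (intro variation_leI) auto
  then show ?thesis by simp
qed

text \<open>
  Here the triangle inequality is essential: without it a partition that jumps over \<open>t\<close>
  may have a larger sum than its refinement.
\<close>
lemma variation_subadditive:
  assumes "a \<le> s" "s \<le> t" "t \<le> r" "r \<le> b"
    and tri: "\<And>x y. s \<le> x \<Longrightarrow> x < t \<Longrightarrow> t < y \<Longrightarrow> y \<le> r \<Longrightarrow> f x y \<le> f x t + f t y"
  shows "variation f s r \<le> variation f s t + variation f t r"
proof (rule variation_leI)
  show "s \<le> r" using assms by simp
  fix S assume "chain_sum f s r S"
  then obtain S1 S2 where "chain_sum f s t S1" "chain_sum f t r S2" "S \<le> S1 + S2"
    using chain_sum_split[of f s r S t] assms by blast
  then show "S \<le> variation f s t + variation f t r"
    using chain_le_variation[of s t S1] chain_le_variation[of t r S2] assms by simp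
qed

end

section \<open>Comparison of Lebesgue--Stieltjes measures\<close>

lemma UN_Ioc_symmetric: "(\<Union>n::nat. {- real n<..real n}) = UNIV"
proof safe
  fix x :: real
  obtain n :: nat where "\<bar>x\<bar> < real n" using reals_Archimedean2 by blast
  then show "x \<in> (\<Union>n::nat. {- real n<..real n})" by (intro UN_I[of n]) auto
qed auto

text \<open>
  Half-open intervals form an intersection-stable generator of the Borel sets on which both
  measures are finite.
\<close>
lemma measure_eq_interval_measureI:
  fixes F :: "real \<Rightarrow> real"
  assumes M: "sets M = sets borel"
    and mono: "mono F" and rc: "\<And>x. continuous (at_right x) F"
    and eq: "\<And>x y. x < y \<Longrightarrow> emeasure M {x<..y} = ennreal (F y - F x)"
  shows "M = interval_measure F"
proof (rule measure_eqI_generator_eq[where E="range (\<lambda>(x, y). {x<..y::real})"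
      and A="\<lambda>n::nat. {- real n<..real n}" and \<Omega>=UNIV])
  have F: "emeasure (interval_measure F) {x<..y} = (if x \<le> y then F y - F x else 0)" for x y
    by (rule emeasure_interval_measure_Ioc_eq) (auto intro: monoD[OF mono] rc)
  have eq': "emeasure M {x<..y} = ennreal (F y - F x)" if "x \<le> y" for x y
    using that eq by (cases "x = y") auto
  show "Int_stable (range (\<lambda>(x, y). {x<..y::real}))"
    unfolding Int_stable_def
  proof (intro ballI)
    fix A B :: "real set"
    assume "A \<in> range (\<lambda>(x, y). {x<..y})" "B \<in> range (\<lambda>(x, y). {x<..y})"
    then obtain a b c d where "A = {a<..b}" "B = {c<..d}" by auto
    then show "A \<inter> B \<in> range (\<lambda>(x, y). {x<..y})"
      by (intro image_eqI[of _ _ "(max a c, min b d)"]) auto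
  qed
  show "emeasure M X = emeasure (interval_measure F) X"
    if "X \<in> range (\<lambda>(x, y). {x<..y::real})" for X
    using that by (auto simp: F eq')
  show "emeasure M {- real n<..real n} \<noteq> \<infinity>" for n
    by (subst eq') auto
  show "(\<Union>n::nat. {- real n<..real n}) = UNIV" by (rule UN_Ioc_symmetric)
  show "sets M = sigma_sets UNIV (range (\<lambda>(x, y). {x<..y::real}))"
    "sets (interval_measure F) = sigma_sets UNIV (range (\<lambda>(x, y). {x<..y::real}))"
    using M by (simp_all add: borel_sigma_sets_Ioc)
qed auto

lemma emeasure_interval_measure_linear:
  fixes F G :: "real \<Rightarrow> real"
  assumes F: "mono F" "\<And>x. continuous (at_right x) F"
    and G: "mono G" "\<And>x. continuous (at_right x) G"
    and pq: "0 \<le> p" "0 \<le> q" and E: "E \<in> sets borel"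
  shows "emeasure (interval_measure (\<lambda>x. p * F x + q * G x)) E
    = ennreal p * emeasure (interval_measure F) E + ennreal q * emeasure (interval_measure G) E"
proof -
  let ?\<mu> = "\<lambda>A. ennreal p * emeasure (interval_measure F) A + ennreal q * emeasure (interval_measure G) A"
  define M where "M = measure_of UNIV (sets borel) ?\<mu>"
  have sets: "sets M = sets borel"
    unfolding M_def using sets.sigma_sets_eq[of "borel :: real measure"]
    by (simp add: sets_measure_of_conv)
  have em: "emeasure M A = ?\<mu> A" if "A \<in> sets borel" for A
  proof (rule emeasure_measure_of_sigma[of UNIV "sets borel" ?\<mu> A, folded M_def])
    show "sigma_algebra UNIV (sets (borel :: real measure))"
      using sets.sigma_algebra_axioms[of "borel :: real measure"] by simp
    show "positive (sets borel) ?\<mu>" by (simp add: positive_def)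
    show "countably_additive (sets borel) ?\<mu>"
    proof (rule countably_additiveI)
      fix A :: "nat \<Rightarrow> real set" assume A: "range A \<subseteq> sets borel" "disjoint_family A"
      have *: "(\<Sum>i. emeasure (interval_measure H) (A i)) = emeasure (interval_measure H) (\<Union> (range A))" for H
        using A by (intro suminf_emeasure) auto
      show "(\<Sum>i. ?\<mu> (A i)) = ?\<mu> (\<Union> (range A))"
        by (simp add: suminf_add[symmetric] ennreal_suminf_cmult *)
    qed
  qed (fact that)
  have I: "emeasure (interval_measure F) {x<..y} = ennreal (F y - F x)"
    "emeasure (interval_measure G) {x<..y} = ennreal (G y - G x)" if "x < y" for x y
    using that F G by (auto intro!: emeasure_interval_measure_Ioc intro: monoD[OF F(1)] monoD[OF G(1)])
  have "M = interval_measure (\<lambda>x. p * F x + q * G x)"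
  proof (rule measure_eq_interval_measureI[OF sets])
    show "mono (\<lambda>x. p * F x + q * G x)"
      using pq by (intro monoI add_mono mult_left_mono monoD[OF F(1)] monoD[OF G(1)])
    show "continuous (at_right x) (\<lambda>x. p * F x + q * G x)" for x
      using F(2) G(2) by (intro continuous_intros) auto
    fix x y :: real assume xy: "x < y"
    have "0 \<le> F y - F x" "0 \<le> G y - G x" using xy monoD[OF F(1), of x y] monoD[OF G(1), of x y] by auto
    then have "?\<mu> {x<..y} = ennreal (p * (F y - F x) + q * (G y - G x))"
      using xy pq by (simp add: I ennreal_mult'' ennreal_plus)
    also have "p * (F y - F x) + q * (G y - G x) = p * F y + q * G y - (p * F x + q * G x)"
      by (simp add: algebra_simps)
    finally show "emeasure M {x<..y} = ennreal (p * F y + q * G y - (p * F x + q * G x))"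
      using em by simp
  qed
  then show ?thesis using em[OF E] by simp
qed

text \<open>
  The hypothesis says that \<open>H x = q * x + V x - p * F x\<close> is nondecreasing, hence has
  a Stieltjes measure of its own. Since \<open>p * F + H = q * x + V\<close>, the inequality on intervals
  extends to Borel sets by adding a nonnegative measure, with no approximation by intervals.
\<close>
lemma emeasure_interval_measure_mono:
  fixes F G V :: "real \<Rightarrow> real"
  assumes F: "mono F" "\<And>x. continuous (at_right x) F"
    and V: "mono V" "\<And>x. continuous (at_right x) V"
    and pq: "0 \<le> p" "0 \<le> q" and E: "E \<in> sets borel"
    and le: "\<And>x y. x < y \<Longrightarrow> p * (F y - F x) \<le> q * (y - x) + (V y - V x)"
  shows "ennreal p * emeasure (interval_measure F) E
    \<le> ennreal q * emeasure lborel E + emeasure (interval_measure V) E"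
proof -
  define H where "H = (\<lambda>x. q * x + 1 * V x - p * F x)"
  have H: "mono H"
  proof (rule monoI)
    fix x y :: real assume "x \<le> y"
    then show "H x \<le> H y" using le[of x y] by (cases "x = y") (auto simp: H_def algebra_simps)
  qed
  have Hc: "continuous (at_right x) H" for x
    unfolding H_def using V F by (intro continuous_intros) auto
  have id: "mono (\<lambda>x::real. x)" by (simp add: monoI)
  have eq: "(\<lambda>x. p * F x + 1 * H x) = (\<lambda>x. q * x + 1 * V x)" by (auto simp: H_def)
  have "ennreal p * emeasure (interval_measure F) E
    \<le> ennreal p * emeasure (interval_measure F) E + ennreal 1 * emeasure (interval_measure H) E"
    by simp
  also have "\<dots> = emeasure (interval_measure (\<lambda>x. q * x + 1 * V x)) E"
    using emeasure_interval_measure_linear[OF F H Hc pq(1) _ E, of 1] eq by simp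
  also have "\<dots> = ennreal q * emeasure lborel E + emeasure (interval_measure V) E"
    using emeasure_interval_measure_linear[OF id _ V pq(2) _ E, of 1]
    by (simp add: lborel_eq_real)
  finally show ?thesis .
qed

text \<open>
  A variation function may jump, whereas Stieltjes measures need right-continuity; passing to
  the right limits preserves monotonicity and bounds.
\<close>
lemma right_limit_regularization:
  fixes V W :: "real \<Rightarrow> real"
  assumes W_def: "\<And>x. W x = (INF y\<in>{x<..}. V y)"
    and V: "mono V" "\<And>x. 0 \<le> V x" "\<And>x. V x \<le> K"
  shows "mono W" "\<And>x. continuous (at_right x) W" "\<And>x. 0 \<le> W x" "\<And>x. W x \<le> K"
    "\<And>x y. x < y \<Longrightarrow> W x \<le> V y"
    "\<And>x e. 0 < e \<Longrightarrow> \<exists>y>x. V y < W x + e"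
proof -
  have bb: "bdd_below (V ` {x<..})" for x using V(2) by (auto intro!: bdd_belowI)
  have ne: "V ` {x<..} \<noteq> {}" for x by (simp add: greaterThan_non_empty)
  show up: "W x \<le> V y" if "x < y" for x y
    unfolding W_def using that bb by (intro cINF_lower) auto
  show ex: "\<exists>y>x. V y < W x + e" if "0 < e" for x e
    using cInf_lessD[OF ne, of x "W x + e"] that unfolding W_def by auto
  have below: "V x \<le> W x" for x
    unfolding W_def by (intro cINF_greatest) (auto intro: monoD[OF V(1)])
  show mono: "mono W"
  proof (rule monoI)
    fix x y :: real assume "x \<le> y"
    then show "W x \<le> W y"
      using up[of x y] below[of y] by (cases "x = y") auto
  qed
  show "0 \<le> W x" for x using V(2)[of x] below[of x] by simp
  show "W x \<le> K" for x using up[of x "x + 1"] V(3)[of "x + 1"] by simp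
  show "continuous (at_right x) W" for x
    unfolding continuous_within
  proof (rule order_tendstoI)
    fix c assume "c < W x"
    then show "\<forall>\<^sub>F y in at_right x. c < W y"
      using monoD[OF mono, of x] by (auto simp: eventually_at_filter less_le_trans intro!: always_eventually)
  next
    fix c assume "W x < c"
    then obtain y where y: "x < y" "V y < c" using ex[of "c - W x" x] by auto
    then have "\<forall>\<^sub>F z in at_right x. z \<in> {x<..<y}" by (intro eventually_at_right_real)
    then show "\<forall>\<^sub>F z in at_right x. W z < c"
      by eventually_elim (use up y in fastforce)
  qed
qed

section \<open>The Riesz--Medvedev theorem\<close>

text \<open>Monotonicity makes the slope of the supporting line nonnegative, so that its estimates
  can be multiplied with nonnegative measures.\<close>
lemma mono_convex_support:
  fixes \<Phi> :: "real \<Rightarrow> real"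
  assumes "convex_on UNIV \<Phi>" "mono \<Phi>"
  obtains D where "0 \<le> D" "\<And>y. \<Phi> x + D * (y - x) \<le> \<Phi> y"
proof -
  define D where "D = Inf ((\<lambda>t. (\<Phi> x - \<Phi> t) / (x - t)) ` ({x<..} \<inter> UNIV))"
  have D: "\<Phi> x + D * (y - x) \<le> \<Phi> y" for y
    unfolding D_def using assms(1) by (intro convex_le_Inf_differential) auto
  have "\<Phi> (x - 1) \<le> \<Phi> x" by (intro monoD[OF assms(2)]) simp
  then have "0 \<le> D" using D[of "x - 1"] by simp
  then show ?thesis using D by (rule that)
qed

text \<open>This is how superlinearity is used: slopes \<open>p\<close> of affine minorants are arbitrarily large.\<close>
lemma superlinear_affine_bound:
  fixes \<Phi> :: "real \<Rightarrow> real"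
  assumes "filterlim (\<lambda>r. \<Phi> r / r) at_top at_top" "\<And>r. 0 \<le> r \<Longrightarrow> 0 \<le> \<Phi> r" "0 \<le> p"
  obtains q where "0 \<le> q" "\<And>r. 0 \<le> r \<Longrightarrow> p * r \<le> q + \<Phi> r"
proof -
  have "\<forall>\<^sub>F r in at_top. p \<le> \<Phi> r / r"
    using assms(1) by (simp add: filterlim_at_top)
  then obtain R where R: "\<And>r. R \<le> r \<Longrightarrow> p \<le> \<Phi> r / r"
    by (auto simp: eventually_at_top_linorder)
  show ?thesis
  proof (rule that[of "p * max R 0"])
    show "0 \<le> p * max R 0" using assms(3) by simp
    fix r :: real assume r: "0 \<le> r"
    show "p * r \<le> p * max R 0 + \<Phi> r"
    proof (cases "r \<le> max R 0")
      case True
      then show ?thesis using mult_left_mono[OF True assms(3)] assms(2)[OF r] by simp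
    next
      case False
      then have "p * r \<le> \<Phi> r" using R[of r] by (simp add: pos_le_divide_eq)
      moreover have "0 \<le> p * max R 0" using assms(3) by simp
      ultimately show ?thesis by linarith
    qed
  qed
qed

text \<open>
  A nondecreasing function whose difference quotients have bounded \<open>\<Phi>\<close>-energy is the integral of
  a density with finite \<open>\<Phi>\<close>-energy. For every affine minorant \<open>p * r - q\<close> of \<open>\<Phi>\<close>, the hypothesis
  gives \<open>p * \<mu> E \<le> q * |E| + \<nu> E\<close> on Borel sets, where \<open>\<mu>\<close> and the finite measure \<open>\<nu>\<close> are the Stieltjes
  measures of \<open>F\<close> and of the right-continuous version of \<open>V\<close>. On a Lebesgue null set, letting \<open>p\<close>
  grow yields \<open>\<mu> E = 0\<close>, so \<open>\<mu>\<close> has a density \<open>\<beta>\<close>. On a set where \<open>\<beta> \<ge> x\<close>, the supporting line at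
  \<open>x\<close> yields \<open>\<Phi> x * |E| \<le> \<nu> E\<close>; summing over the level sets of \<open>\<beta>\<close> rounded down to multiples
  of \<open>1/n\<close>, and letting \<open>n\<close> tend to infinity with Fatou's lemma, bounds the integral of \<open>\<Phi> \<circ> \<beta>\<close> by
  the total mass of \<open>\<nu>\<close>.
\<close>
theorem Riesz_Medvedev:
  fixes \<Phi> F V :: "real \<Rightarrow> real"
  assumes conv: "convex_on UNIV \<Phi>" and mono\<Phi>: "mono \<Phi>" and nonneg: "\<And>r. 0 \<le> \<Phi> r"
    and zero: "\<Phi> 0 = 0" and super: "filterlim (\<lambda>r. \<Phi> r / r) at_top at_top"
    and F: "mono F" and V: "mono V" "\<And>x. 0 \<le> V x" "\<And>x. V x \<le> K"
    and le: "\<And>x y. x < y \<Longrightarrow> (y - x) * \<Phi> ((F y - F x) / (y - x)) \<le> V y - V x"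
  obtains \<beta> where "\<beta> \<in> borel_measurable borel" "\<And>x. 0 \<le> \<beta> x"
    "integrable lborel (\<lambda>x. \<Phi> (\<beta> x))"
    "\<And>s t. s \<le> t \<Longrightarrow> set_integrable lborel {s<..t} \<beta>"
    "\<And>s t. s \<le> t \<Longrightarrow> (LINT x:{s<..t}|lborel. \<beta> x) = F t - F s"
proof -
  have affine: "p * (F y - F x) \<le> q * (y - x) + (V y - V x)"
    if "x < y" "\<And>r. 0 \<le> r \<Longrightarrow> p * r \<le> q + \<Phi> r" for p q x y
  proof -
    let ?r = "(F y - F x) / (y - x)"
    have "0 \<le> ?r" using that(1) monoD[OF F, of x y] by simp
    then have "p * ?r \<le> q + \<Phi> ?r" by (rule that(2))
    then have "(y - x) * (p * ?r) \<le> (y - x) * (q + \<Phi> ?r)"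
      using that(1) by (intro mult_left_mono) auto
    also have "(y - x) * (p * ?r) = p * (F y - F x)" using that(1) by simp
    finally show ?thesis using le[OF that(1)] by (simp add: algebra_simps)
  qed
  have Fc: "continuous (at_right x) F" for x
    unfolding continuous_within
  proof (rule order_tendstoI)
    fix c assume "c < F x"
    then show "\<forall>\<^sub>F y in at_right x. c < F y"
      using monoD[OF F, of x] by (auto simp: eventually_at_filter less_le_trans intro!: always_eventually)
  next
    fix c assume c: "F x < c"
    define e where "e = c - F x"
    have e: "e > 0" using c by (simp add: e_def)
    have K: "0 \<le> K" using V(2,3)[of 0] by simp
    \<comment> \<open>The slope makes the contribution \<open>K / p\<close> of \<open>V\<close> at most \<open>e / 2\<close>; the distance
      \<open>1 / (q + 1)\<close> then keeps the linear term below \<open>1\<close>.\<close>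
    define p where "p = 2 * (K + 1) / e"
    have p: "p > 0" using K e by (simp add: p_def)
    obtain q where q: "0 \<le> q" "\<And>r. 0 \<le> r \<Longrightarrow> p * r \<le> q + \<Phi> r"
      using superlinear_affine_bound[OF super nonneg, of p] p by auto
    have "x < x + 1 / (q + 1)" using q by simp
    then have "\<forall>\<^sub>F y in at_right x. y \<in> {x<..<x + 1 / (q + 1)}" by (rule eventually_at_right_real)
    then show "\<forall>\<^sub>F y in at_right x. F y < c"
    proof eventually_elim
      case (elim y)
      have "p * (F y - F x) \<le> q * (y - x) + (V y - V x)" using affine[of x y p q] elim q by auto
      moreover have "q * (y - x) \<le> q * (1 / (q + 1))" using elim q(1) by (intro mult_left_mono) auto
      moreover have "q * (1 / (q + 1)) < 1" using q(1) by (simp add: field_simps)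
      ultimately have "p * (F y - F x) < K + 1" using V(2)[of x] V(3)[of y] by linarith
      also have "\<dots> < p * e" using e K by (simp add: p_def)
      finally show ?case using p by (simp add: e_def)
    qed
  qed
  define W where "W x = (INF y\<in>{x<..}. V y)" for x
  note W = right_limit_regularization[of W V K, OF W_def V]
  have affineW: "p * (F y - F x) \<le> q * (y - x) + (W y - W x)"
    if "x < y" "0 \<le> p" "0 \<le> q" and pq: "\<And>r. 0 \<le> r \<Longrightarrow> p * r \<le> q + \<Phi> r" for p q x y
  proof -
    \<comment> \<open>Both endpoints are moved to the right before the inequality for \<open>V\<close> is used:
      \<open>x'\<close> to keep \<open>W x \<le> V x'\<close>, and \<open>y'\<close> so near \<open>y\<close> that \<open>V y'\<close> almost equals \<open>W y\<close>.\<close>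
    have "p * (F y - F x') \<le> q * (y - x) + (W y - W x)" if x': "x < x'" "x' < y" for x'
    proof (rule field_le_epsilon)
      fix e :: real assume "0 < e"
      define d where "d = e / (2 * (q + 1))"
      have d: "0 < d" "q * d \<le> e / 2" using \<open>0 < e\<close> \<open>0 \<le> q\<close> by (auto simp: d_def field_simps)
      obtain y0 where y0: "y < y0" "V y0 < W y + e / 2" using W(6)[of "e / 2" y] \<open>0 < e\<close> by auto
      define y' where "y' = min y0 (y + d)"
      have y': "y < y'" "V y' < W y + e / 2" "y' \<le> y + d"
        using y0 d(1) monoD[OF V(1), of y' y0] by (auto simp: y'_def)
      have "p * (F y - F x') \<le> p * (F y' - F x')"
        using monoD[OF F, of y y'] y' \<open>0 \<le> p\<close> by (intro mult_left_mono) auto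
      also have "\<dots> \<le> q * (y' - x') + (V y' - V x')"
        by (rule affine[OF _ pq]) (use x' y' in auto)
      also have "q * (y' - x') \<le> q * (y - x + d)"
        using \<open>0 \<le> q\<close> x' y' by (intro mult_left_mono) auto
      finally show "p * (F y - F x') \<le> q * (y - x) + (W y - W x) + e"
        using y' d W(5)[OF x'(1)] by (simp add: algebra_simps)
    qed
    moreover have "\<forall>\<^sub>F x' in at_right x. x' \<in> {x<..<y}"
      using \<open>x < y\<close> by (rule eventually_at_right_real)
    ultimately have ev: "\<forall>\<^sub>F x' in at_right x. p * (F y - F x') \<le> q * (y - x) + (W y - W x)"
      by (auto elim: eventually_mono)
    have "((\<lambda>x'. p * (F y - F x')) \<longlongrightarrow> p * (F y - F x)) (at_right x)"
      using Fc[of x] unfolding continuous_within by (intro tendsto_intros)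
    then show ?thesis using ev by (rule tendsto_upperbound) simp
  qed
  define \<mu> where "\<mu> = interval_measure F"
  define \<nu> where "\<nu> = interval_measure W"
  have sets[simp, measurable_cong]: "sets \<mu> = sets borel" "sets \<nu> = sets borel"
    by (simp_all add: \<mu>_def \<nu>_def)
  have dom: "ennreal p * emeasure \<mu> E \<le> ennreal q * emeasure lborel E + emeasure \<nu> E"
    if "0 \<le> p" "0 \<le> q" "\<And>r. 0 \<le> r \<Longrightarrow> p * r \<le> q + \<Phi> r" "E \<in> sets borel" for p q E
    unfolding \<mu>_def \<nu>_def
    using that by (intro emeasure_interval_measure_mono[OF F Fc W(1,2)] affineW) auto
  have \<nu>_total: "emeasure \<nu> UNIV \<le> ennreal K"
  proof (rule LIMSEQ_le_const2)
    have "(\<lambda>n. emeasure \<nu> {- real n<..real n}) \<longlonglongrightarrow> emeasure \<nu> (\<Union>n::nat. {- real n<..real n})"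
      by (intro Lim_emeasure_incseq) (auto simp: incseq_def)
    then show "(\<lambda>n. emeasure \<nu> {- real n<..real n}) \<longlonglongrightarrow> emeasure \<nu> UNIV"
      by (simp only: UN_Ioc_symmetric)
    have "emeasure \<nu> {- real n<..real n} \<le> ennreal K" for n
      unfolding \<nu>_def using W(3)[of "- real n"] W(4)[of "real n"]
      by (subst emeasure_interval_measure_Ioc) (auto intro!: monoD[OF W(1)] W(2) ennreal_leI)
    then show "\<exists>N. \<forall>n\<ge>N. emeasure \<nu> {- real n<..real n} \<le> ennreal K" by blast
  qed
  have ac: "absolutely_continuous lborel \<mu>"
    unfolding absolutely_continuous_def
  proof
    fix N :: "real set" assume N: "N \<in> null_sets lborel"
    have "emeasure \<mu> N = 0"
    proof (rule ccontr)
      assume *: "emeasure \<mu> N \<noteq> 0"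
      have bd: "ennreal p * emeasure \<mu> N \<le> ennreal K" if p: "0 \<le> p" for p
      proof -
        obtain q where q: "0 \<le> q" "\<And>r. 0 \<le> r \<Longrightarrow> p * r \<le> q + \<Phi> r"
          using superlinear_affine_bound[OF super nonneg p] by auto
        have "ennreal p * emeasure \<mu> N \<le> ennreal q * emeasure lborel N + emeasure \<nu> N"
          using N by (intro dom p q) auto
        also have "\<dots> \<le> emeasure \<nu> UNIV"
          using N by (simp add: null_setsD1 emeasure_mono)
        finally show ?thesis using \<nu>_total by (rule order_trans)
      qed
      have K: "0 \<le> K" using V(2,3)[of 0] by simp
      obtain m where m: "emeasure \<mu> N = ennreal m" "m > 0"
        using bd[of 1] * by (cases "emeasure \<mu> N") (auto simp: top_unique zero_less_iff_neq_zero)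
      have "ennreal ((K + 1) / m) * ennreal m \<le> ennreal K"
        using bd[of "(K + 1) / m"] m K by simp
      also have "ennreal ((K + 1) / m) * ennreal m = ennreal (K + 1)"
        using m(2) K by (simp add: ennreal_mult'[symmetric])
      finally show False using K by simp
    qed
    then show "N \<in> null_sets \<mu>" using null_setsD2[OF N] by (intro null_setsI) auto
  qed
  obtain f where f[measurable]: "f \<in> borel_measurable lborel" and dens: "density lborel f = \<mu>"
    using sigma_finite_measure.Radon_Nikodym[OF sigma_finite_lborel ac] by auto
  have "sigma_finite_measure \<mu>"
    unfolding \<mu>_def by (rule sigma_finite_interval_measure) (auto intro: monoD[OF F] Fc)
  then have fin: "AE x in lborel. f x \<noteq> \<infinity>"
    using sigma_finite_measure.sigma_finite_iff_density_finite[OF sigma_finite_lborel, of f] dens by simp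
  define \<beta> where "\<beta> = (\<lambda>x. enn2real (f x))"
  have \<beta>m[measurable]: "\<beta> \<in> borel_measurable borel" unfolding \<beta>_def using f by simp
  have \<beta>0: "0 \<le> \<beta> x" for x by (simp add: \<beta>_def)
  have \<beta>f: "AE x in lborel. ennreal (\<beta> x) = f x"
    using fin by eventually_elim (auto simp: \<beta>_def ennreal_enn2real_if)
  have \<mu>_eq: "emeasure \<mu> E = (\<integral>\<^sup>+x\<in>E. ennreal (\<beta> x) \<partial>lborel)" if "E \<in> sets borel" for E
  proof -
    have "emeasure \<mu> E = (\<integral>\<^sup>+x\<in>E. f x \<partial>lborel)"
      using that by (simp add: dens[symmetric] emeasure_density)
    also have "\<dots> = (\<integral>\<^sup>+x\<in>E. ennreal (\<beta> x) \<partial>lborel)"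
      using \<beta>f by (intro nn_integral_cong_AE) auto
    finally show ?thesis .
  qed
  have level: "ennreal (\<Phi> x) * emeasure lborel E \<le> emeasure \<nu> E"
    if E[measurable]: "E \<in> sets borel" and x: "0 \<le> x" "\<And>z. z \<in> E \<Longrightarrow> x \<le> \<beta> z" for x E
  proof -
    obtain D where D: "0 \<le> D" "\<And>y. \<Phi> x + D * (y - x) \<le> \<Phi> y"
      using mono_convex_support[OF conv mono\<Phi>] by blast
    define q where "q = D * x - \<Phi> x"
    have q: "0 \<le> q" using D(2)[of 0] zero by (simp add: q_def)
    have sup: "D * r \<le> q + \<Phi> r" for r using D(2)[of r] by (simp add: q_def algebra_simps)
    \<comment> \<open>The terms \<open>q * |A|\<close> on both sides cancel only if \<open>|A|\<close> is finite, hence the detour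
      over bounded pieces of \<open>E\<close>.\<close>
    have bounded: "ennreal (\<Phi> x) * emeasure lborel A \<le> emeasure \<nu> A"
      if A[measurable]: "A \<in> sets borel" and sub: "A \<subseteq> E" and finA: "emeasure lborel A < \<infinity>" for A
    proof -
      have "ennreal x * emeasure lborel A = (\<integral>\<^sup>+z\<in>A. ennreal x \<partial>lborel)"
        by (simp add: nn_integral_cmult_indicator)
      also have "\<dots> \<le> (\<integral>\<^sup>+z\<in>A. ennreal (\<beta> z) \<partial>lborel)"
        using x(2) sub by (intro nn_integral_mono) (auto simp: indicator_def intro!: ennreal_leI)
      also have "\<dots> = emeasure \<mu> A" by (simp add: \<mu>_eq)
      finally have "ennreal D * (ennreal x * emeasure lborel A) \<le> ennreal D * emeasure \<mu> A"
        by (intro mult_left_mono) auto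
      also have "\<dots> \<le> ennreal q * emeasure lborel A + emeasure \<nu> A"
        using D(1) q sup by (intro dom) auto
      finally have "ennreal (q + \<Phi> x) * emeasure lborel A \<le> ennreal q * emeasure lborel A + emeasure \<nu> A"
        using D(1) x(1) by (simp add: q_def ennreal_mult mult.assoc)
      then have "ennreal q * emeasure lborel A + ennreal (\<Phi> x) * emeasure lborel A
        \<le> ennreal q * emeasure lborel A + emeasure \<nu> A"
        using q nonneg[of x] by (simp add: ennreal_plus distrib_right)
      moreover have "ennreal q * emeasure lborel A \<noteq> top"
        using finA by (simp add: ennreal_mult_eq_top_iff)
      ultimately show ?thesis by (simp add: ennreal_add_left_cancel_le)
    qed
    define A where "A = (\<lambda>n::nat. E \<inter> {- real n..real n})"
    have A: "(\<Union>n. A n) = E"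
    proof safe
      fix z assume "z \<in> E"
      obtain n :: nat where "\<bar>z\<bar> < real n" using reals_Archimedean2 by blast
      then show "z \<in> (\<Union>n. A n)" using \<open>z \<in> E\<close> by (intro UN_I[of n]) (auto simp: A_def)
    qed (auto simp: A_def)
    have "(\<lambda>n. emeasure lborel (A n)) \<longlonglongrightarrow> emeasure lborel (\<Union>n. A n)"
      by (intro Lim_emeasure_incseq) (auto simp: incseq_def A_def)
    then have lim: "(\<lambda>n. ennreal (\<Phi> x) * emeasure lborel (A n)) \<longlonglongrightarrow> ennreal (\<Phi> x) * emeasure lborel E"
      unfolding A by (intro ennreal_tendsto_cmult) auto
    have le: "ennreal (\<Phi> x) * emeasure lborel (A n) \<le> emeasure \<nu> E" for n
    proof -
      have "emeasure lborel (A n) \<le> emeasure lborel {- real n..real n}"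
        by (intro emeasure_mono) (auto simp: A_def)
      also have "\<dots> < \<infinity>" by simp
      finally have "ennreal (\<Phi> x) * emeasure lborel (A n) \<le> emeasure \<nu> (A n)"
        by (intro bounded) (auto simp: A_def)
      also have "\<dots> \<le> emeasure \<nu> E" by (intro emeasure_mono) (auto simp: A_def)
      finally show ?thesis .
    qed
    show ?thesis using LIMSEQ_le_const2[OF lim] le by blast
  qed
  have \<Phi>cont: "continuous_on UNIV \<Phi>" using conv by (intro convex_on_continuous) auto
  have \<Phi>m[measurable]: "\<Phi> \<in> borel_measurable borel"
    using \<Phi>cont by (rule borel_measurable_continuous_onI)
  define \<phi> where "\<phi> = (\<lambda>n z. \<Phi> (real (nat \<lfloor>real (Suc n) * \<beta> z\<rfloor>) / real (Suc n)))"
  have step: "(\<integral>\<^sup>+z. ennreal (\<phi> n z) \<partial>lborel) \<le> ennreal K" for n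
  proof -
    define E where "E = (\<lambda>k. {z. nat \<lfloor>real (Suc n) * \<beta> z\<rfloor> = k})"
    have E[measurable]: "E k \<in> sets borel" for k unfolding E_def by measurable
    have disj: "disjoint_family E" by (auto simp: disjoint_family_on_def E_def)
    have un: "(\<Union>k. E k) = UNIV" by (auto simp: E_def)
    have "(\<integral>\<^sup>+z. ennreal (\<phi> n z) \<partial>lborel) =
      (\<integral>\<^sup>+z. (\<Sum>k. ennreal (\<Phi> (real k / real (Suc n))) * indicator (E k) z) \<partial>lborel)"
    proof (intro nn_integral_cong)
      fix z
      let ?k = "nat \<lfloor>real (Suc n) * \<beta> z\<rfloor>"
      have "(\<Sum>k. ennreal (\<Phi> (real k / real (Suc n))) * indicator (E k) z)
        = (\<Sum>k\<in>{?k}. ennreal (\<Phi> (real k / real (Suc n))) * indicator (E k) z)"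
        by (intro suminf_finite) (auto simp: E_def)
      then show "ennreal (\<phi> n z) = (\<Sum>k. ennreal (\<Phi> (real k / real (Suc n))) * indicator (E k) z)"
        by (simp add: \<phi>_def E_def)
    qed
    also have "\<dots> = (\<Sum>k. ennreal (\<Phi> (real k / real (Suc n))) * emeasure lborel (E k))"
      by (subst nn_integral_suminf) (auto simp: nn_integral_cmult_indicator)
    also have "\<dots> \<le> (\<Sum>k. emeasure \<nu> (E k))"
    proof (intro suminf_le level)
      fix k z assume "z \<in> E k"
      then have "real k = real_of_int \<lfloor>real (Suc n) * \<beta> z\<rfloor>"
        using \<beta>0[of z] by (auto simp: E_def)
      then have "real k \<le> real (Suc n) * \<beta> z" by linarith
      then show "real k / real (Suc n) \<le> \<beta> z" by (simp add: divide_le_eq mult.commute)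
    qed auto
    also have "\<dots> = emeasure \<nu> (\<Union>k. E k)"
      using disj by (intro suminf_emeasure) auto
    also have "\<dots> \<le> ennreal K" unfolding un by (rule \<nu>_total)
    finally show ?thesis .
  qed
  have conv_pt: "(\<lambda>n. ennreal (\<phi> n z)) \<longlonglongrightarrow> ennreal (\<Phi> (\<beta> z))" for z
  proof -
    have "(\<lambda>n. real (nat \<lfloor>real (Suc n) * \<beta> z\<rfloor>) / real (Suc n)) \<longlonglongrightarrow> \<beta> z"
    proof (rule tendsto_sandwich)
      have fl: "real (nat \<lfloor>real (Suc n) * \<beta> z\<rfloor>) = of_int \<lfloor>real (Suc n) * \<beta> z\<rfloor>" for n
        using \<beta>0[of z] by simp
      have up: "real (nat \<lfloor>real (Suc n) * \<beta> z\<rfloor>) / real (Suc n) \<le> \<beta> z" for n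
        unfolding fl divide_le_eq using of_int_floor_le[of "real (Suc n) * \<beta> z"]
        by (simp add: mult.commute)
      have "real (Suc n) * \<beta> z - 1 \<le> real (nat \<lfloor>real (Suc n) * \<beta> z\<rfloor>)" for n
        unfolding fl by linarith
      then have lo: "\<beta> z - 1 / real (Suc n) \<le> real (nat \<lfloor>real (Suc n) * \<beta> z\<rfloor>) / real (Suc n)" for n
        using divide_right_mono[of "real (Suc n) * \<beta> z - 1" "real (nat \<lfloor>real (Suc n) * \<beta> z\<rfloor>)" "real (Suc n)"]
        by (simp add: diff_divide_distrib del: of_nat_Suc)
      show "\<forall>\<^sub>F n in sequentially. real (nat \<lfloor>real (Suc n) * \<beta> z\<rfloor>) / real (Suc n) \<le> \<beta> z"
        using up by simp
      show "\<forall>\<^sub>F n in sequentially. \<beta> z - 1 / real (Suc n) \<le> real (nat \<lfloor>real (Suc n) * \<beta> z\<rfloor>) / real (Suc n)"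
        using lo by simp
      have "(\<lambda>n. \<beta> z - inverse (real (Suc n))) \<longlonglongrightarrow> \<beta> z - 0"
        by (intro tendsto_diff tendsto_const LIMSEQ_inverse_real_of_nat)
      then show "(\<lambda>n. \<beta> z - 1 / real (Suc n)) \<longlonglongrightarrow> \<beta> z"
        by (simp add: inverse_eq_divide)
    qed simp
    then show ?thesis
      unfolding \<phi>_def using \<Phi>cont
      by (intro tendsto_ennrealI isCont_tendsto_compose[of "\<beta> z" \<Phi>])
        (auto simp: continuous_on_eq_continuous_at)
  qed
  have "(\<integral>\<^sup>+z. ennreal (\<Phi> (\<beta> z)) \<partial>lborel) = (\<integral>\<^sup>+z. liminf (\<lambda>n. ennreal (\<phi> n z)) \<partial>lborel)"
    by (intro nn_integral_cong lim_imp_Liminf[symmetric] conv_pt) simp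
  also have "\<dots> \<le> liminf (\<lambda>n. \<integral>\<^sup>+z. ennreal (\<phi> n z) \<partial>lborel)"
    by (intro nn_integral_liminf) (simp add: \<phi>_def)
  also have "\<dots> \<le> ennreal K"
    by (intro Liminf_le) (auto simp: step)
  finally have "(\<integral>\<^sup>+z. ennreal (\<Phi> (\<beta> z)) \<partial>lborel) \<le> ennreal K" .
  then have "(\<integral>\<^sup>+z. ennreal (\<Phi> (\<beta> z)) \<partial>lborel) < \<infinity>"
    by (rule order.strict_trans1) simp
  then have int: "integrable lborel (\<lambda>z. \<Phi> (\<beta> z))"
    using nonneg by (intro integrableI_nonneg) auto
  have loc: "has_bochner_integral lborel (\<lambda>x. indicator {s<..t} x *\<^sub>R \<beta> x) (F t - F s)"
    if st: "s \<le> t" for s t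
  proof (rule has_bochner_integral_nn_integral)
    have "(\<integral>\<^sup>+x. ennreal (indicator {s<..t} x *\<^sub>R \<beta> x) \<partial>lborel) = (\<integral>\<^sup>+x\<in>{s<..t}. ennreal (\<beta> x) \<partial>lborel)"
      by (intro nn_integral_cong) (auto simp: indicator_def)
    also have "\<dots> = emeasure \<mu> {s<..t}" by (simp add: \<mu>_eq)
    also have "\<dots> = ennreal (F t - F s)"
      unfolding \<mu>_def using st by (intro emeasure_interval_measure_Ioc) (auto intro: monoD[OF F] Fc)
    finally show "(\<integral>\<^sup>+x. ennreal (indicator {s<..t} x *\<^sub>R \<beta> x) \<partial>lborel) = ennreal (F t - F s)" .
  qed (use st \<beta>0 monoD[OF F, of s t] in auto)
  show ?thesis
  proof (rule that[OF \<beta>m \<beta>0 int])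
    fix s t :: real assume "s \<le> t"
    from loc[OF this] show "set_integrable lborel {s<..t} \<beta>"
      "(LINT x:{s<..t}|lborel. \<beta> x) = F t - F s"
      by (auto simp: set_integrable_def set_lebesgue_integral_def has_bochner_integral_iff)
  qed
qed

section \<open>Convexity and the passage from increments to integrals\<close>

lemma variation_compare:
  assumes f: "bounded_variation f a b K" and g: "bounded_variation g a b K'"
    and st: "a \<le> s" "s \<le> t" "t \<le> b" and pc: "0 \<le> p" "0 \<le> c"
    and le: "\<And>x y. s \<le> x \<Longrightarrow> x < y \<Longrightarrow> y \<le> t \<Longrightarrow> p * f x y \<le> q * (y - x) + c * g x y"
  shows "p * variation f s t \<le> q * (t - s) + c * variation g s t"
proof -
  interpret f: bounded_variation f a b K by (fact f)
  interpret g: bounded_variation g a b K' by (fact g)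
  have chain: "p * S \<le> q * (t - s) + c * variation g s t" if S: "chain_sum f s t S" for S
  proof -
    obtain S' where "chain_sum g s t S'" "p * S \<le> q * (t - s) + c * S'"
      using chain_sum_compare[OF S le] by blast
    moreover from this have "c * S' \<le> c * variation g s t"
      using g.chain_le_variation[of s t S'] st pc by (intro mult_left_mono) auto
    ultimately show ?thesis by simp
  qed
  show ?thesis
  proof (cases "p = 0")
    case True
    then show ?thesis using chain chain_sum_exists[OF st(2), of f] by auto
  next
    case False
    then have p: "p > 0" using pc by simp
    have "variation f s t \<le> (q * (t - s) + c * variation g s t) / p"
      using chain p by (intro f.variation_leI st(2)) (simp add: pos_le_divide_eq mult.commute)
    then show ?thesis using p by (simp add: pos_le_divide_eq mult.commute)
  qed
qed

text \<open>
  Since \<open>\<Phi>\<close> is nondecreasing, the supporting line at \<open>r\<close> also serves when \<open>r\<close> is merely below the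
  mean of \<open>\<beta>\<close>.
\<close>
lemma Jensen_Ioc:
  fixes \<Phi> \<beta> :: "real \<Rightarrow> real"
  assumes \<Phi>: "convex_on UNIV \<Phi>" "mono \<Phi>" and st: "s < t"
    and int: "set_integrable lborel {s<..t} \<beta>" "set_integrable lborel {s<..t} (\<lambda>x. \<Phi> (\<beta> x))"
    and r: "r * (t - s) \<le> (LINT x:{s<..t}|lborel. \<beta> x)"
  shows "(t - s) * \<Phi> r \<le> (LINT x:{s<..t}|lborel. \<Phi> (\<beta> x))"
proof -
  obtain D where D: "0 \<le> D" "\<And>y. \<Phi> r + D * (y - r) \<le> \<Phi> y"
    using mono_convex_support[OF \<Phi>] by blast
  have const: "set_integrable lborel {s<..t} (\<lambda>x. \<Phi> r - D * r)"
    unfolding set_integrable_def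
    by (intro integrable_scaleR_left impI integrable_real_indicator) (use st in auto)
  have D\<beta>: "set_integrable lborel {s<..t} (\<lambda>x. D * \<beta> x)" using int(1) by simp
  have "(LINT x:{s<..t}|lborel. (\<Phi> r - D * r) + D * \<beta> x)
    = (LINT x:{s<..t}|lborel. \<Phi> r - D * r) + (LINT x:{s<..t}|lborel. D * \<beta> x)"
    by (rule set_integral_add(2)[OF const D\<beta>])
  also have "(LINT x:{s<..t}|lborel. \<Phi> r - D * r) = (t - s) * (\<Phi> r - D * r)"
    using st by (simp add: set_lebesgue_integral_def)
  also have "(LINT x:{s<..t}|lborel. D * \<beta> x) = D * (LINT x:{s<..t}|lborel. \<beta> x)"
    by (rule set_integral_mult_right)
  finally have eq: "(LINT x:{s<..t}|lborel. (\<Phi> r - D * r) + D * \<beta> x)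
    = (t - s) * (\<Phi> r - D * r) + D * (LINT x:{s<..t}|lborel. \<beta> x)" .
  have "D * (r * (t - s)) \<le> D * (LINT x:{s<..t}|lborel. \<beta> x)"
    using r D(1) by (rule mult_left_mono)
  then have "(t - s) * \<Phi> r \<le> (LINT x:{s<..t}|lborel. (\<Phi> r - D * r) + D * \<beta> x)"
    unfolding eq by (simp add: algebra_simps)
  also have "\<dots> \<le> (LINT x:{s<..t}|lborel. \<Phi> (\<beta> x))"
  proof (rule set_integral_mono[OF _ int(2)])
    show "set_integrable lborel {s<..t} (\<lambda>x. (\<Phi> r - D * r) + D * \<beta> x)"
      by (rule set_integral_add(1)[OF const D\<beta>])
    show "(\<Phi> r - D * r) + D * \<beta> x \<le> \<Phi> (\<beta> x)" for x
      using D(2)[of "\<beta> x"] by (simp add: algebra_simps)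
  qed
  finally show ?thesis .
qed

lemma convex_half_line_mono:
  fixes \<psi> :: "real \<Rightarrow> real"
  assumes "convex_on {0..} \<psi>" "\<psi> 0 = 0" "\<And>r. 0 \<le> r \<Longrightarrow> 0 \<le> \<psi> r" "0 \<le> x" "x \<le> y"
  shows "\<psi> x \<le> \<psi> y"
proof (cases "y = 0")
  case False
  then have y: "y > 0" using assms by simp
  have t: "0 \<le> x / y" "x / y \<le> 1" using assms y by auto
  have "\<psi> ((1 - x / y) *\<^sub>R 0 + (x / y) *\<^sub>R y) \<le> (1 - x / y) * \<psi> 0 + (x / y) * \<psi> y"
    using t y by (intro convex_onD[OF assms(1)]) auto
  then have "\<psi> x \<le> (x / y) * \<psi> y" using y assms(2) by simp
  also have "\<dots> \<le> 1 * \<psi> y" using t assms y by (intro mult_right_mono) auto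
  finally show ?thesis by simp
qed (use assms in auto)

text \<open>
  Extension by \<open>\<psi> 0 = 0\<close> to the negative axis makes every \<open>r \<ge> 0\<close> an interior point, so that
  supporting lines exist and continuity is automatic also at \<open>0\<close>.
\<close>
lemma convex_extension:
  fixes \<psi> :: "real \<Rightarrow> real"
  assumes \<psi>: "convex_on {0..} \<psi>" "\<psi> 0 = 0" "\<And>r. 0 \<le> r \<Longrightarrow> 0 \<le> \<psi> r"
  shows "convex_on UNIV (\<lambda>r. \<psi> (max 0 r))" "mono (\<lambda>r. \<psi> (max 0 r))"
proof -
  note up = convex_half_line_mono[OF \<psi>]
  show "mono (\<lambda>r. \<psi> (max 0 r))" by (rule monoI, rule up) auto
  show "convex_on UNIV (\<lambda>r. \<psi> (max 0 r))"
  proof (rule convex_onI)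
    fix t x y :: real assume t: "0 < t" "t < 1"
    have "(1 - t) * x \<le> (1 - t) * max 0 x" "t * y \<le> t * max 0 y"
      using t by (simp_all add: mult_left_mono)
    moreover have "0 \<le> (1 - t) * max 0 x" "0 \<le> t * max 0 y"
      using t by simp_all
    ultimately have "max 0 ((1 - t) *\<^sub>R x + t *\<^sub>R y) \<le> (1 - t) *\<^sub>R max 0 x + t *\<^sub>R max 0 y"
      unfolding real_scaleR_def max.bounded_iff by linarith
    then have "\<psi> (max 0 ((1 - t) *\<^sub>R x + t *\<^sub>R y)) \<le> \<psi> ((1 - t) *\<^sub>R max 0 x + t *\<^sub>R max 0 y)"
      by (intro up) auto
    also have "\<dots> \<le> (1 - t) * \<psi> (max 0 x) + t * \<psi> (max 0 y)"
      using t by (intro convex_onD[OF \<psi>(1)]) auto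
    finally show "\<psi> (max 0 ((1 - t) *\<^sub>R x + t *\<^sub>R y)) \<le> (1 - t) * \<psi> (max 0 x) + t * \<psi> (max 0 y)" .
  qed simp
qed

lemma set_integral_Ioo_lebesgue:
  fixes g :: "real \<Rightarrow> real"
  assumes [measurable]: "g \<in> borel_measurable borel"
  shows "(LINT x:{s<..<t}|lebesgue. g x) = (LINT x:{s<..t}|lborel. g x)"
proof -
  have "(LINT x:{s<..<t}|lebesgue. g x) = (LINT x:{s<..<t}|lborel. g x)"
    unfolding set_lebesgue_integral_def by (rule integral_completion) measurable
  also have "\<dots> = (LINT x:{s<..t}|lborel. g x)"
    unfolding set_lebesgue_integral_def
    by (rule integral_cong_AE, measurable, use AE_lborel_singleton[of t] in eventually_elim)
      (auto simp: indicator_def)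
  finally show ?thesis .
qed

section \<open>Curves of finite action\<close>

lemma chain_sum_le_action:
  assumes "chain_sum (\<lambda>s t. \<a> (t - s) (u s) (u t)) a b S"
  shows "ereal S \<le> action \<a> u a b"
proof -
  obtain M \<tau> where P: "(M, \<tau>) \<in> partitions a b"
    "S = (\<Sum>j=1..M. \<a> (\<tau> j - \<tau> (j - 1)) (u (\<tau> (j - 1))) (u (\<tau> j)))"
    using chain_sum_partition[OF assms] by blast
  show ?thesis
    unfolding action_def P(2) by (rule SUP_upper2[OF P(1)]) simp
qed

theorem theorem7p3:
  fixes X :: "'x set" and \<a> :: "real \<Rightarrow> 'x \<Rightarrow> 'x \<Rightarrow> real"
    and u :: "real \<Rightarrow> 'x" and a b :: real
  assumes "action_cost X \<a>"
    and "uniformly_superlinear X \<a>"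
    and "a \<le> b"
    and "u \<in> {a..b} \<rightarrow> X"
    and "action \<a> u a b < \<infinity>"
  shows "u \<in> AC X \<a> a b"
proof -
  obtain \<b> \<psi> \<Lambda> where \<b>: "action_cost X \<b>" and \<psi>: "convex_superlinear \<psi>" and \<Lambda>: "1 \<le> \<Lambda>"
    and sandwich: "\<And>\<tau> v w. 0 < \<tau> \<Longrightarrow> v \<in> X \<Longrightarrow> w \<in> X \<Longrightarrow>
          inverse \<Lambda> * (\<tau> * \<psi> (inverse \<tau> * \<b> \<tau> v w)) \<le> \<a> \<tau> v w \<and>
          \<a> \<tau> v w \<le> \<Lambda> * (\<tau> * \<psi> (inverse \<tau> * \<b> \<tau> v w))"
    using assms(2) unfolding uniformly_superlinear_def by blast
  have uX: "u x \<in> X" if "a \<le> x" "x \<le> b" for x using assms(4) that by auto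
  have \<psi>0: "0 \<le> \<psi> r" if "0 \<le> r" for r using \<psi> that by (auto simp: convex_superlinear_def)
  have \<psi>conv: "convex_on {0..} \<psi>" using \<psi> by (simp add: convex_superlinear_def)
  \<comment> \<open>The action of a constant step vanishes, and so does \<open>\<b>\<close> there.\<close>
  have "\<psi> 0 = 0"
  proof -
    have ua: "u a \<in> X" using uX assms(3) by simp
    have "c 1 (u a) (u a) = 0" if "action_cost X c" for c
      using that ua by (simp add: action_cost_def)
    then have "\<a> 1 (u a) (u a) = 0" "\<b> 1 (u a) (u a) = 0" using assms(1) \<b> by auto
    then have "inverse \<Lambda> * \<psi> 0 \<le> 0" using sandwich[of 1 "u a" "u a"] ua by simp
    then have "\<psi> 0 \<le> 0" using \<Lambda> by (simp add: mult_le_0_iff)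
    then show ?thesis using \<psi>0[of 0] by simp
  qed
  define \<Phi> where "\<Phi> = (\<lambda>r. \<psi> (max 0 r))"
  have \<Phi>: "convex_on UNIV \<Phi>" "mono \<Phi>"
    unfolding \<Phi>_def by (rule convex_extension[OF \<psi>conv \<open>\<psi> 0 = 0\<close> \<psi>0]; simp)+
  have \<Phi>nonneg: "0 \<le> \<Phi> r" for r using \<psi>0 by (simp add: \<Phi>_def)
  have \<Phi>0: "\<Phi> 0 = 0" using \<open>\<psi> 0 = 0\<close> by (simp add: \<Phi>_def)
  have \<Phi>super: "filterlim (\<lambda>r. \<Phi> r / r) at_top at_top"
  proof (rule filterlim_cong[THEN iffD1, OF HOL.refl HOL.refl])
    show "filterlim (\<lambda>r. \<psi> r / r) at_top at_top" using \<psi> by (simp add: convex_superlinear_def)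
    show "\<forall>\<^sub>F r in at_top. \<psi> r / r = \<Phi> r / r"
      using eventually_ge_at_top[of 0] by eventually_elim (simp add: \<Phi>_def max_def)
  qed
  have \<b>_triangle: "\<b> (\<sigma> + \<tau>) x z \<le> \<b> \<sigma> x y + \<b> \<tau> y z"
    if "0 < \<sigma>" "0 < \<tau>" "x \<in> X" "y \<in> X" "z \<in> X" for \<sigma> \<tau> x y z
    using \<b> that unfolding action_cost_def by blast
  define A where "A = (\<lambda>s t. \<a> (t - s) (u s) (u t))"
  define B where "B = (\<lambda>s t. \<b> (t - s) (u s) (u t))"
  have A0: "0 \<le> A x y" and B0: "0 \<le> B x y" if "a \<le> x" "x < y" "y \<le> b" for x y
    using assms(1) \<b> uX[of x] uX[of y] that unfolding A_def B_def action_cost_def by auto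
  have lower: "(y - x) * \<Phi> (B x y / (y - x)) \<le> \<Lambda> * A x y"
    and upper: "A x y \<le> \<Lambda> * ((y - x) * \<Phi> (B x y / (y - x)))"
    if xy: "a \<le> x" "x < y" "y \<le> b" for x y
  proof -
    have eq: "\<psi> (inverse (y - x) * B x y) = \<Phi> (B x y / (y - x))"
      using B0[OF xy] xy by (simp add: \<Phi>_def max_def divide_inverse mult.commute)
    have *: "inverse \<Lambda> * ((y - x) * \<Phi> (B x y / (y - x))) \<le> A x y \<and>
      A x y \<le> \<Lambda> * ((y - x) * \<Phi> (B x y / (y - x)))"
      using sandwich[of "y - x" "u x" "u y"] uX[of x] uX[of y] xy eq
      unfolding A_def B_def by simp
    then show "A x y \<le> \<Lambda> * ((y - x) * \<Phi> (B x y / (y - x)))" by blast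
    have "(y - x) * \<Phi> (B x y / (y - x)) = \<Lambda> * (inverse \<Lambda> * ((y - x) * \<Phi> (B x y / (y - x))))"
      using \<Lambda> by (simp add: mult.assoc[symmetric])
    also have "\<dots> \<le> \<Lambda> * A x y"
      using * \<Lambda> by (intro mult_left_mono) auto
    finally show "(y - x) * \<Phi> (B x y / (y - x)) \<le> \<Lambda> * A x y" .
  qed
  have affine: "p * B x y \<le> q * (y - x) + \<Lambda> * A x y"
    if xy: "a \<le> x" "x < y" "y \<le> b" and pq: "\<And>r. 0 \<le> r \<Longrightarrow> p * r \<le> q + \<Phi> r" for p q x y
  proof -
    have "p * (B x y / (y - x)) \<le> q + \<Phi> (B x y / (y - x))"
      using B0[OF xy] xy by (intro pq) auto
    then have "(y - x) * (p * (B x y / (y - x))) \<le> (y - x) * (q + \<Phi> (B x y / (y - x)))"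
      using xy by (intro mult_left_mono) auto
    then have "p * B x y \<le> (y - x) * (q + \<Phi> (B x y / (y - x)))" using xy by simp
    also have "\<dots> = q * (y - x) + (y - x) * \<Phi> (B x y / (y - x))" by (simp add: algebra_simps)
    finally show ?thesis using lower[OF xy] by simp
  qed
  define K where "K = real_of_ereal (action \<a> u a b)"
  interpret A: bounded_variation A a b K
  proof
    fix S assume "chain_sum A a b S"
    then have "ereal S \<le> action \<a> u a b"
      unfolding A_def by (rule chain_sum_le_action)
    then show "S \<le> K" using assms(5) unfolding K_def by (cases "action \<a> u a b") auto
  qed (rule A0)
  obtain q0 where q0: "0 \<le> q0" "\<And>r. 0 \<le> r \<Longrightarrow> 1 * r \<le> q0 + \<Phi> r"
    using superlinear_affine_bound[OF \<Phi>super \<Phi>nonneg, of 1] by auto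
  interpret B: bounded_variation B a b "q0 * (b - a) + \<Lambda> * K"
  proof
    fix S assume "chain_sum B a b S"
    then obtain S' where "chain_sum A a b S'" "1 * S \<le> q0 * (b - a) + \<Lambda> * S'"
      using chain_sum_compare[of B a b S 1 q0 \<Lambda> A] affine q0(2) by blast
    moreover from this have "\<Lambda> * S' \<le> \<Lambda> * K"
      using A.bound \<Lambda> by (intro mult_left_mono) auto
    ultimately show "S \<le> q0 * (b - a) + \<Lambda> * K" by simp
  qed (rule B0)
  \<comment> \<open>Clamping the argument to \<open>{a..b}\<close> extends the two variation functions to constants outside.\<close>
  define cl where "cl x = max a (min b x)" for x
  have cl: "a \<le> cl x" "cl x \<le> b" for x using assms(3) by (auto simp: cl_def)
  have cl_mono: "cl x \<le> cl y" "cl y - cl x \<le> y - x" if "x \<le> y" for x y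
    using that assms(3) by (auto simp: cl_def)
  have cl_id: "cl x = x" if "a \<le> x" "x \<le> b" for x using that by (simp add: cl_def)
  define F where "F x = variation B a (cl x)" for x
  define V where "V x = \<Lambda> * variation A a (cl x)" for x
  have F_ge: "variation B (cl x) (cl y) \<le> F y - F x" if "x \<le> y" for x y
    using B.variation_superadditive[of a "cl x" "cl y"] cl cl_mono(1)[OF that] by (simp add: F_def)
  have F_le: "F y - F x \<le> variation B (cl x) (cl y)" if "x \<le> y" for x y
  proof -
    have tri: "B z w \<le> B z v + B v w" if "a \<le> z" "z < v" "v < w" "w \<le> b" for z v w
    proof -
      have "\<b> ((v - z) + (w - v)) (u z) (u w) \<le> \<b> (v - z) (u z) (u v) + \<b> (w - v) (u v) (u w)"
        using that by (intro \<b>_triangle uX) auto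
      then show ?thesis by (simp add: B_def)
    qed
    have "variation B a (cl y) \<le> variation B a (cl x) + variation B (cl x) (cl y)"
      using tri cl[of x] cl[of y] cl_mono(1)[OF that] by (intro B.variation_subadditive) auto
    then show ?thesis by (simp add: F_def)
  qed
  have V_ge: "\<Lambda> * variation A (cl x) (cl y) \<le> V y - V x" if "x \<le> y" for x y
  proof -
    have "\<Lambda> * (variation A a (cl x) + variation A (cl x) (cl y)) \<le> \<Lambda> * variation A a (cl y)"
      using A.variation_superadditive[of a "cl x" "cl y"] cl cl_mono(1)[OF that] \<Lambda>
      by (intro mult_left_mono) auto
    then show ?thesis by (simp add: V_def algebra_simps)
  qed
  have F: "mono F"
  proof (rule monoI)
    fix x y :: real assume xy: "x \<le> y"
    have "0 \<le> variation B (cl x) (cl y)"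
      using cl cl_mono(1)[OF xy] by (intro B.variation_range) auto
    then show "F x \<le> F y" using F_ge[OF xy] by simp
  qed
  have V: "mono V"
  proof (rule monoI)
    fix x y :: real assume xy: "x \<le> y"
    have "0 \<le> \<Lambda> * variation A (cl x) (cl y)"
      using cl cl_mono(1)[OF xy] \<Lambda> by (intro mult_nonneg_nonneg A.variation_range) auto
    then show "V x \<le> V y" using V_ge[OF xy] by simp
  qed
  have V0: "0 \<le> V x" and VK: "V x \<le> \<Lambda> * K" for x
    using A.variation_range[of a "cl x"] cl[of x] \<Lambda> unfolding V_def
    by (auto intro!: mult_nonneg_nonneg mult_left_mono)
  have quotient: "(y - x) * \<Phi> ((F y - F x) / (y - x)) \<le> V y - V x" if xy: "x < y" for x y
  proof -
    \<comment> \<open>Jensen's inequality for sums over arbitrary partitions, obtained from the single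
      supporting line at the difference quotient of \<open>F\<close>.\<close>
    define r where "r = (F y - F x) / (y - x)"
    have r: "F y - F x = r * (y - x)" using xy by (simp add: r_def)
    obtain D where D: "0 \<le> D" "\<And>z. \<Phi> r + D * (z - r) \<le> \<Phi> z"
      using mono_convex_support[OF \<Phi>] by blast
    define q where "q = D * r - \<Phi> r"
    have q: "0 \<le> q" using D(2)[of 0] \<Phi>0 by (simp add: q_def)
    have pq: "D * z \<le> q + \<Phi> z" for z using D(2)[of z] by (simp add: q_def algebra_simps)
    have "D * (F y - F x) \<le> D * variation B (cl x) (cl y)"
      using F_le xy D(1) by (intro mult_left_mono) auto
    also have "\<dots> \<le> q * (cl y - cl x) + \<Lambda> * variation A (cl x) (cl y)"
    proof (rule variation_compare[OF B.bounded_variation_axioms A.bounded_variation_axioms])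
      show "D * B z w \<le> q * (w - z) + \<Lambda> * A z w" if "cl x \<le> z" "z < w" "w \<le> cl y" for z w
        using that cl[of x] cl[of y] by (intro affine pq) auto
    qed (use cl cl_mono xy D \<Lambda> in auto)
    also have "\<dots> \<le> q * (y - x) + (V y - V x)"
      using xy q by (intro add_mono mult_left_mono cl_mono V_ge) auto
    finally show ?thesis unfolding r_def[symmetric] unfolding r q_def by (simp add: algebra_simps)
  qed
  obtain \<beta> where \<beta>[measurable]: "\<beta> \<in> borel_measurable borel" and "\<And>x. 0 \<le> \<beta> x"
    and int: "integrable lborel (\<lambda>x. \<Phi> (\<beta> x))"
    and \<beta>int: "\<And>s t. s \<le> t \<Longrightarrow> set_integrable lborel {s<..t} \<beta>"
      "\<And>s t. s \<le> t \<Longrightarrow> (LINT x:{s<..t}|lborel. \<beta> x) = F t - F s"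
    by (rule Riesz_Medvedev[OF \<Phi> \<Phi>nonneg \<Phi>0 \<Phi>super F V V0 VK]) (rule quotient that; assumption)+
  define g where "g = (\<lambda>x. \<Lambda> * \<Phi> (\<beta> x))"
  have gint: "integrable lborel g" unfolding g_def using int by simp
  then have gm: "g \<in> borel_measurable borel" by simp
  have "set_integrable lebesgue {a<..<b} g"
  proof -
    have "integrable lebesgue g" using gint gm by (simp add: integrable_completion)
    then show ?thesis unfolding set_integrable_def by (intro integrable_mult_indicator) auto
  qed
  moreover have "\<a> (t - s) (u s) (u t) \<le> (LINT r:{s<..<t}|lebesgue. g r)"
    if st: "a \<le> s" "s < t" "t \<le> b" for s t
  proof -
    have "B s t \<le> variation B s t"
      using st by (intro B.chain_le_variation chain_sum_single) auto
    also have "\<dots> \<le> F t - F s" using F_ge[of s t] cl_id st by simp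
    also have "\<dots> = (LINT x:{s<..t}|lborel. \<beta> x)" using \<beta>int st by simp
    finally have *: "B s t / (t - s) * (t - s) \<le> (LINT x:{s<..t}|lborel. \<beta> x)" using st by simp
    have "set_integrable lborel {s<..t} (\<lambda>x. \<Phi> (\<beta> x))"
      using int unfolding set_integrable_def by (intro integrable_mult_indicator) auto
    then have J: "(t - s) * \<Phi> (B s t / (t - s)) \<le> (LINT x:{s<..t}|lborel. \<Phi> (\<beta> x))"
      using st \<beta>int(1) * by (intro Jensen_Ioc[OF \<Phi>]) auto
    have "A s t \<le> \<Lambda> * ((t - s) * \<Phi> (B s t / (t - s)))" by (rule upper[OF st])
    also have "\<dots> \<le> \<Lambda> * (LINT x:{s<..t}|lborel. \<Phi> (\<beta> x))"
      using J \<Lambda> by (intro mult_left_mono) auto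
    also have "\<dots> = (LINT r:{s<..t}|lborel. g r)" by (simp add: g_def)
    also have "\<dots> = (LINT r:{s<..<t}|lebesgue. g r)" using set_integral_Ioo_lebesgue[OF gm] by simp
    finally show ?thesis by (simp add: A_def)
  qed
  ultimately show ?thesis unfolding AC_def using assms(4) by blast
qed

end
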